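(* Let $f:\mathbb{R}^n\to\mathbb{R}$ be of class $C^2$, convex, $L$-smooth and bounded below, with $f^\star:=\inf f$ and $\phi(x_1):=f(x_1)-f^\star$. Consider the system $\dot x_1=x_2$, $\dot x_2=u$ with $x_1,x_2,u\in\mathbb{R}^n$. Let $k_1>0$, $\alpha(x_1):=-k_1\nabla f(x_1)$, $e:=x_2-\alpha(x_1)=x_2+k_1\nabla f(x_1)$, and $V_1(x_1):=\phi(x_1)$. Then: (a) Along $\dot x_1=\alpha(x_1)+e$ one has $$\dot V_1=-k_1\|\nabla f(x_1)\|^2+\nabla f(x_1)^\top e .$$ Hence, with $c_\phi=1$, $\sigma=k_1$, $\lambda=1$, the following conditions hold: $V_1\ge c_\phi\phi$; $\dot V_1=-\sigma\|\nabla f(x_1)\|^2+\lambda\nabla f(x_1)^\top e$ along $\dot x_1=\alpha(x_1)+e$; and boundedness of $\nabla f(x_1)$ implies boundedness of $\alpha(x_1)$. (b) Let $k_2>0$. If $u=\dot\alpha-k_2e-\nabla f(x_1)$, where $\dot\alpha$ is the total derivative of $\alpha(x_1)$ along the system, then $$u=-k_2\bigl(x_2+k_1\nabla f(x_1)\bigr)-\nabla f(x_1)-k_1\nabla^2f(x_1)x_2,$$ the resulting second-order dynamics for $X=x_1$ are $$\ddot X+k_2\dot X+(1+k_1k_2)\nabla f(X)+k_1\nabla^2f(X)\dot X=0,$$ and every corresponding closed-loop trajectory on $[0,\infty)$ satisfies $\nabla f(x_1(t))\to0$ as $t\to\infty$.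
   Context: $\|\cdot\|$ is the Euclidean norm. $L$-smooth means $\|\nabla f(x)-\nabla f(y)\|\le L\|x-y\|$ for all $x,y\in\mathbb{R}^n$. A dot denotes the time derivative along trajectories. *)

theory Defs
  imports "HOL-Analysis.Analysis"
begin

definition grad :: "('a::real_inner \<Rightarrow> real) \<Rightarrow> 'a \<Rightarrow> 'a" where
  "grad f x = (THE D. GDERIV f x :> D)"

definition hessian :: "(real ^ 'n \<Rightarrow> real) \<Rightarrow> real ^ 'n \<Rightarrow> real ^ 'n ^ 'n" where
  "hessian f x = jacobian (grad f) (at x)"

definition C2 :: "(real ^ 'n \<Rightarrow> real) \<Rightarrow> bool" where
  "C2 f \<longleftrightarrow> (\<forall>x. f differentiable at x) \<and> (\<forall>x. grad f differentiable at x)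
      \<and> continuous_on UNIV (hessian f)"

definition L_smooth :: "real \<Rightarrow> ('a::real_inner \<Rightarrow> real) \<Rightarrow> bool" where
  "L_smooth L f \<longleftrightarrow> (\<forall>x. f differentiable at x)
      \<and> (\<forall>x y. norm (grad f x - grad f y) \<le> L * norm (x - y))"

definition phi :: "('a \<Rightarrow> real) \<Rightarrow> 'a \<Rightarrow> real" where
  "phi f x = f x - (INF y. f y)"

definition alpha :: "real \<Rightarrow> ('a::real_inner \<Rightarrow> real) \<Rightarrow> 'a \<Rightarrow> 'a" where
  "alpha k1 f x1 = - k1 *\<^sub>R grad f x1"

definition V1 :: "('a \<Rightarrow> real) \<Rightarrow> 'a \<Rightarrow> real" where
  "V1 f x1 = phi f x1"

text \<open>The error variable e for a virtual control law \<open>al\<close>, as a function of the state.\<close>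

definition err :: "('a::real_vector \<Rightarrow> 'a) \<Rightarrow> 'a \<Rightarrow> 'a \<Rightarrow> 'a" where
  "err al x1 x2 = x2 - al x1"

text \<open>Trajectories live on a nondegenerate interval \<open>T\<close>, so that derivatives within \<open>T\<close>
  (one-sided at an endpoint belonging to \<open>T\<close>) are unique.\<close>

definition time_interval :: "real set \<Rightarrow> bool" where
  "time_interval T \<longleftrightarrow> is_interval T \<and> interior T \<noteq> {}"

definition dot :: "real set \<Rightarrow> (real \<Rightarrow> 'a::real_normed_vector) \<Rightarrow> real \<Rightarrow> 'a" where
  "dot T y t = vector_derivative y (at t within T)"

text \<open>\<open>x1\<close> and \<open>x2\<close> satisfy x1' = al(x1) + e on \<open>T\<close>; since e = x2 - al(x1) and \<open>x2\<close> is an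
  arbitrary function of time, so is the signal e.\<close>

definition virtual_trajectory ::
  "('a::real_normed_vector \<Rightarrow> 'a) \<Rightarrow> real set \<Rightarrow> (real \<Rightarrow> 'a) \<Rightarrow> (real \<Rightarrow> 'a) \<Rightarrow> bool" where
  "virtual_trajectory al T x1 x2 \<longleftrightarrow> time_interval T \<and>
     (\<forall>t\<in>T. (x1 has_vector_derivative (al (x1 t) + err al (x1 t) (x2 t))) (at t within T))"

text \<open>The last clause ranges over arbitrary sets of states, in particular over the range of a
  trajectory.\<close>

definition virtual_control_conditions ::
  "('a::real_inner \<Rightarrow> real) \<Rightarrow> ('a \<Rightarrow> real) \<Rightarrow> ('a \<Rightarrow> 'a) \<Rightarrow> real \<Rightarrow> real \<Rightarrow> real \<Rightarrow> bool" where
  "virtual_control_conditions f V al c_phi \<sigma> lam \<longleftrightarrow>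
     (\<forall>x1. V x1 \<ge> c_phi * phi f x1) \<and>
     (\<forall>T x1 x2. virtual_trajectory al T x1 x2 \<longrightarrow>
        (\<forall>t\<in>T. ((\<lambda>s. V (x1 s)) has_real_derivative
            (- \<sigma> * (norm (grad f (x1 t)))\<^sup>2 + lam * (grad f (x1 t) \<bullet> err al (x1 t) (x2 t))))
          (at t within T))) \<and>
     (\<forall>S. bounded (grad f ` S) \<longrightarrow> bounded (al ` S))"

definition system_trajectory ::
  "real set \<Rightarrow> (real \<Rightarrow> 'a::real_normed_vector) \<Rightarrow> (real \<Rightarrow> 'a) \<Rightarrow> (real \<Rightarrow> 'a) \<Rightarrow> bool" where
  "system_trajectory T x1 x2 u \<longleftrightarrow> time_interval T \<and>
     (\<forall>t\<in>T. (x1 has_vector_derivative x2 t) (at t within T) \<and>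
            (x2 has_vector_derivative u t) (at t within T))"

text \<open>The value at time \<open>t\<close> of the control u = (d/dt) alpha - k2 e - grad f, where the first term
  is the time derivative of alpha(x1) along the trajectory.\<close>

definition control ::
  "real \<Rightarrow> real \<Rightarrow> ('a::real_inner \<Rightarrow> real) \<Rightarrow> real set \<Rightarrow> (real \<Rightarrow> 'a) \<Rightarrow> (real \<Rightarrow> 'a) \<Rightarrow> real \<Rightarrow> 'a"
  where
  "control k1 k2 f T x1 x2 t =
     dot T (\<lambda>s. alpha k1 f (x1 s)) t - k2 *\<^sub>R err (alpha k1 f) (x1 t) (x2 t) - grad f (x1 t)"

definition closed_loop_trajectory ::
  "real \<Rightarrow> real \<Rightarrow> ('a::real_inner \<Rightarrow> real) \<Rightarrow> real set
     \<Rightarrow> (real \<Rightarrow> 'a) \<Rightarrow> (real \<Rightarrow> 'a) \<Rightarrow> (real \<Rightarrow> 'a) \<Rightarrow> bool" where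
  "closed_loop_trajectory k1 k2 f T x1 x2 u \<longleftrightarrow> system_trajectory T x1 x2 u \<and>
     (\<forall>t\<in>T. u t = control k1 k2 f T x1 x2 t)"

definition solves_second_order ::
  "real \<Rightarrow> real \<Rightarrow> (real ^ 'n \<Rightarrow> real) \<Rightarrow> real set \<Rightarrow> (real \<Rightarrow> real ^ 'n) \<Rightarrow> bool" where
  "solves_second_order k1 k2 f T X \<longleftrightarrow>
     (\<exists>X' X''. \<forall>t\<in>T.
        (X has_vector_derivative X' t) (at t within T) \<and>
        (X' has_vector_derivative X'' t) (at t within T) \<and>
        X'' t + k2 *\<^sub>R X' t + (1 + k1 * k2) *\<^sub>R grad f (X t) + k1 *\<^sub>R (hessian f (X t) *v X' t) = 0)"

end

theory Submission
  imports Defs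
begin

text \<open>
  Write \<open>g t\<close> for the gradient at \<open>x1 t\<close>. Part (a) is the chain rule. In (b) the chain rule turns
  the time derivative of the virtual control into minus \<open>k1\<close> times the Hessian applied to \<open>x2\<close>;
  conversely, on a nondegenerate interval that derivative is unique, so the feedback law and the
  second-order equation say the same thing.

  For the convergence, the control is designed such that the error satisfies \<open>e' = - k2 e - g\<close>. The
  cross terms \<open>g \<bullet> e\<close> therefore cancel in the derivative of the Lyapunov function
  \<open>W = \<phi> (x1) + |e|\<^sup>2 / 2\<close>, which leaves \<open>W' = - k1 |g|\<^sup>2 - k2 |e|\<^sup>2\<close>
  (\<open>closed_loop_lyapunov_derivative\<close>). So \<open>W\<close> decreases and \<open>e\<close> stays bounded; the gradient of a
  smooth function is dominated by its suboptimality gap (\<open>norm_grad_squared_le_phi\<close>), so \<open>g\<close> stays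
  bounded as well. Hence the velocity \<open>x2 = e - k1 g\<close> is bounded and, the gradient being Lipschitz,
  \<open>g\<close> is Lipschitz in time. A Lipschitz signal cannot be large at a late time without being large
  on a whole time interval of fixed length, and each such interval costs \<open>W\<close> a fixed amount, of
  which only finitely many are available (\<open>tendsto_zero_of_dissipation\<close>).
\<close>

section \<open>Gradients, Hessians and the chain rule\<close>

lemma grad_has_derivative:
  fixes f :: "'a::euclidean_space \<Rightarrow> real"
  assumes "f differentiable at x"
  shows "(f has_derivative (\<lambda>h. grad f x \<bullet> h)) (at x)"
proof -
  obtain F where F: "(f has_derivative F) (at x)"
    using assms by (auto simp: differentiable_def)
  interpret F: linear F
    using F by (rule has_derivative_linear)
  \<comment> \<open>the Riesz representative of the derivative\<close>
  define D where "D = (\<Sum>b\<in>Basis. F b *\<^sub>R b)"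
  have "F h = h \<bullet> D" for h
  proof -
    have "F h = F (\<Sum>b\<in>Basis. (h \<bullet> b) *\<^sub>R b)"
      by (simp add: euclidean_representation)
    also have "\<dots> = h \<bullet> D"
      by (simp add: F.sum F.scale D_def inner_sum_right mult.commute)
    finally show ?thesis .
  qed
  then have "F = (\<lambda>h. h \<bullet> D)"
    by blast
  with F have D: "GDERIV f x :> D"
    by (simp add: gderiv_def)
  have "grad f x = D"
    unfolding grad_def
  proof (rule the_equality)
    show "GDERIV f x :> D"
      by (rule D)
  next
    fix D' assume "GDERIV f x :> D'"
    then show "D' = D"
      using D unfolding gderiv_def
      by (metis (no_types) has_derivative_unique inner_commute vector_eq_rdot)
  qed
  with D show ?thesis
    by (simp add: gderiv_def inner_commute)
qed

lemma has_real_derivative_along_curve: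
  fixes f :: "'a::euclidean_space \<Rightarrow> real"
  assumes "f differentiable at (y t)" and "(y has_vector_derivative v) (at t within T)"
  shows "((\<lambda>s. f (y s)) has_real_derivative grad f (y t) \<bullet> v) (at t within T)"
proof -
  have "((\<lambda>s. f (y s)) has_derivative (\<lambda>h. grad f (y t) \<bullet> (h *\<^sub>R v))) (at t within T)"
    using has_derivative_compose[OF assms(2)[unfolded has_vector_derivative_def]
      grad_has_derivative[OF assms(1)]] .
  then show ?thesis
    by (simp add: has_field_derivative_def mult_commute_abs)
qed

lemma grad_has_vector_derivative_along_curve:
  fixes f :: "real ^ 'n \<Rightarrow> real"
  assumes "grad f differentiable at (y t)" and "(y has_vector_derivative v) (at t within T)"
  shows "((\<lambda>s. grad f (y s)) has_vector_derivative hessian f (y t) *v v) (at t within T)"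
proof -
  have "(grad f has_derivative (\<lambda>h. hessian f (y t) *v h)) (at (y t))"
    using assms(1) unfolding hessian_def by (simp add: jacobian_works)
  from has_derivative_compose[OF assms(2)[unfolded has_vector_derivative_def] this]
  show ?thesis
    by (simp add: has_vector_derivative_def matrix_vector_mult_scaleR)
qed

lemma time_interval_at_within_neq_bot:
  assumes "time_interval T" and "t \<in> T"
  shows "at t within T \<noteq> bot"
proof -
  have "connected T" and "interior T \<noteq> {}"
    using assms(1) by (auto simp: time_interval_def is_interval_connected)
  then have "t islimpt T"
    using assms(2) connected_imp_perfect interior_singleton by metis
  then show ?thesis
    by (simp add: trivial_limit_within)
qed

section \<open>The backstepping control law\<close>

lemma virtual_control_energy_derivative:
  fixes f :: "'a::euclidean_space \<Rightarrow> real"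
  assumes "\<And>x. f differentiable at x"
    and "virtual_trajectory (alpha k1 f) T x1 x2" and "t \<in> T"
  shows "((\<lambda>s. V1 f (x1 s)) has_real_derivative
    (- k1 * (norm (grad f (x1 t)))\<^sup>2 + grad f (x1 t) \<bullet> err (alpha k1 f) (x1 t) (x2 t)))
    (at t within T)"
proof -
  have "(x1 has_vector_derivative (alpha k1 f (x1 t) + err (alpha k1 f) (x1 t) (x2 t))) (at t within T)"
    using assms(2,3) by (auto simp: virtual_trajectory_def)
  from DERIV_diff[OF has_real_derivative_along_curve[OF assms(1) this] DERIV_const[of "INF y. f y"]]
  show ?thesis
    by (simp add: V1_def phi_def alpha_def inner_add_right inner_diff_right power2_norm_eq_inner)
qed

lemma control_eq:
  fixes f :: "real ^ 'n \<Rightarrow> real"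
  assumes "\<And>x. grad f differentiable at x" and "time_interval T" and "t \<in> T"
    and "(x1 has_vector_derivative x2 t) (at t within T)"
  shows "control k1 k2 f T x1 x2 t =
    - k2 *\<^sub>R (x2 t + k1 *\<^sub>R grad f (x1 t)) - grad f (x1 t) - k1 *\<^sub>R (hessian f (x1 t) *v x2 t)"
proof -
  have "((\<lambda>s. alpha k1 f (x1 s)) has_vector_derivative - k1 *\<^sub>R (hessian f (x1 t) *v x2 t))
      (at t within T)"
    unfolding alpha_def
    using bounded_linear.has_vector_derivative[OF bounded_linear_scaleR_right
      grad_has_vector_derivative_along_curve[where y = x1, OF assms(1,4)]] .
  then have "dot T (\<lambda>s. alpha k1 f (x1 s)) t = - k1 *\<^sub>R (hessian f (x1 t) *v x2 t)"
    unfolding dot_def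
    by (rule vector_derivative_within[OF time_interval_at_within_neq_bot[OF assms(2,3)]])
  then show ?thesis
    by (simp add: control_def err_def alpha_def)
qed

lemma closed_loop_iff_second_order:
  fixes f :: "real ^ 'n \<Rightarrow> real"
  assumes "\<And>x. grad f differentiable at x" and "time_interval T"
  shows "(\<exists>x2 u. closed_loop_trajectory k1 k2 f T X x2 u) \<longleftrightarrow> solves_second_order k1 k2 f T X"
proof -
  have law_iff: "u t = control k1 k2 f T X x2 t \<longleftrightarrow>
      u t + k2 *\<^sub>R x2 t + (1 + k1 * k2) *\<^sub>R grad f (X t) + k1 *\<^sub>R (hessian f (X t) *v x2 t) = 0"
    if "t \<in> T" and "(X has_vector_derivative x2 t) (at t within T)" for t x2 u
  proof -
    have "u t - control k1 k2 f T X x2 t =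
        u t + k2 *\<^sub>R x2 t + (1 + k1 * k2) *\<^sub>R grad f (X t) + k1 *\<^sub>R (hessian f (X t) *v x2 t)"
      unfolding control_eq[where ?x2.0 = x2, OF assms that] by (simp add: algebra_simps)
    then show ?thesis
      by (metis right_minus_eq)
  qed
  then show ?thesis
    using assms(2)
    unfolding closed_loop_trajectory_def system_trajectory_def solves_second_order_def by blast
qed

section \<open>Boundedness and decay of the gradient\<close>

text \<open>A gradient step of length \<open>1 / (2 M)\<close> lowers the value by at least \<open>|grad f x|\<^sup>2 / (4 M)\<close>,
  because the gradient loses at most half of itself along the step; and no step can lower the value
  below the infimum.\<close>

lemma norm_grad_squared_le_phi:
  fixes f :: "'a::euclidean_space \<Rightarrow> real"
  assumes "L_smooth M f" and "M > 0" and "bdd_below (range f)"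
  shows "(norm (grad f x))\<^sup>2 \<le> 4 * M * phi f x"
proof -
  define g where "g = grad f x"
  define s where "s = 1 / (2 * M)"
  have "s > 0"
    using assms(2) by (simp add: s_def)
  have deriv: "((\<lambda>r. f (x - r *\<^sub>R g)) has_real_derivative grad f (x - r *\<^sub>R g) \<bullet> (- g)) (at r)" for r
  proof (rule has_real_derivative_along_curve[where y = "\<lambda>r. x - r *\<^sub>R g"])
    show "f differentiable at (x - r *\<^sub>R g)"
      using assms(1) by (auto simp: L_smooth_def)
    show "((\<lambda>r. x - r *\<^sub>R g) has_vector_derivative - g) (at r)"
      by (auto intro!: derivative_eq_intros)
  qed
  obtain r where r: "0 < r" "r < s"
    and drop: "f (x - s *\<^sub>R g) - f (x - 0 *\<^sub>R g) = (s - 0) * (grad f (x - r *\<^sub>R g) \<bullet> (- g))"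
    using MVT2[OF \<open>s > 0\<close> deriv] by blast
  have "norm (g - grad f (x - r *\<^sub>R g)) \<le> M * norm (x - (x - r *\<^sub>R g))"
    using assms(1) unfolding L_smooth_def g_def by blast
  also have "\<dots> = M * r * norm g"
    using r by simp
  also have "\<dots> \<le> 1 / 2 * norm g"
    using r assms(2) by (intro mult_right_mono) (auto simp: s_def field_simps)
  finally have "norm (g - grad f (x - r *\<^sub>R g)) * norm g \<le> 1 / 2 * norm g * norm g"
    by (rule mult_right_mono) simp
  then have "(g - grad f (x - r *\<^sub>R g)) \<bullet> g \<le> 1 / 2 * (norm g)\<^sup>2"
    using norm_cauchy_schwarz[of "g - grad f (x - r *\<^sub>R g)" g] by (simp add: power2_eq_square)
  then have "(norm g)\<^sup>2 / 2 \<le> grad f (x - r *\<^sub>R g) \<bullet> g"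
    by (simp add: inner_diff_left power2_norm_eq_inner)
  then have "s * ((norm g)\<^sup>2 / 2) \<le> s * (grad f (x - r *\<^sub>R g) \<bullet> g)"
    using \<open>s > 0\<close> by (intro mult_left_mono) auto
  also have "\<dots> = f x - f (x - s *\<^sub>R g)"
    using drop by simp
  also have "\<dots> \<le> phi f x"
    using cINF_lower[OF assms(3), of "x - s *\<^sub>R g"] by (simp add: phi_def)
  finally show ?thesis
    using assms(2) by (simp add: s_def g_def field_simps)
qed

lemma mvt_on_half_line:
  fixes W :: "real \<Rightarrow> real"
  assumes deriv: "\<And>t. t \<ge> 0 \<Longrightarrow> (W has_real_derivative D t) (at t within {0..})"
    and "0 \<le> a" and "a < b"
  obtains z where "a < z" and "z < b" and "W b - W a = D z * (b - a)"
proof -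
  have "(W has_derivative (*) (D z)) (at z within {a..b})" if "a \<le> z" "z \<le> b" for z
    using deriv[of z] \<open>0 \<le> a\<close> that
    by (auto simp: has_field_derivative_def intro: has_derivative_subset)
  from mvt_simple[OF \<open>a < b\<close> this] that show ?thesis
    by auto
qed

lemma nonincreasing_on_half_line:
  fixes W :: "real \<Rightarrow> real"
  assumes deriv: "\<And>t. t \<ge> 0 \<Longrightarrow> (W has_real_derivative D t) (at t within {0..})"
    and nonpos: "\<And>t. t \<ge> 0 \<Longrightarrow> D t \<le> 0"
    and "0 \<le> a" and "a \<le> b"
  shows "W b \<le> W a"
proof (cases "a = b")
  case False
  then have "a < b"
    using assms(4) by simp
  with deriv \<open>0 \<le> a\<close> obtain z where z: "a < z" "W b - W a = D z * (b - a)"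
    by (rule mvt_on_half_line)
  have "D z * (b - a) \<le> 0"
    using nonpos[of z] z(1) \<open>0 \<le> a\<close> \<open>a < b\<close> by (intro mult_nonpos_nonneg) auto
  with z(2) show ?thesis
    by simp
qed simp

text \<open>A form of Barbalat's lemma in which the integral of \<open>|g|\<^sup>2\<close> is replaced by the decrease of a
  function \<open>W\<close> that is bounded below.\<close>

lemma tendsto_zero_of_dissipation:
  fixes W :: "real \<Rightarrow> real" and g :: "real \<Rightarrow> 'a::real_normed_vector"
  assumes deriv: "\<And>t. t \<ge> 0 \<Longrightarrow> (W has_real_derivative D t) (at t within {0..})"
    and dissipation: "\<And>t. t \<ge> 0 \<Longrightarrow> D t \<le> - c * (norm (g t))\<^sup>2"
    and bdd: "bdd_below (W ` {0..})" and "c > 0"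
    and lipschitz: "K-lipschitz_on {0..} g"
  shows "(g \<longlongrightarrow> 0) at_top"
proof -
  have decreasing: "W b \<le> W a" if "0 \<le> a" "a \<le> b" for a b
  proof (rule nonincreasing_on_half_line[OF deriv _ that])
    show "D z \<le> 0" if "z \<ge> 0" for z
      using dissipation[OF that] \<open>c > 0\<close>
      by (smt (verit) mult_nonneg_nonneg mult_minus_left zero_le_power2)
  qed
  \<comment> \<open>a Lipschitz constant that is positive, so that one can divide by it\<close>
  define B where "B = K + 1"
  have "K \<ge> 0"
    using lipschitz by (rule lipschitz_on_nonneg)
  then have "B > 0"
    by (simp add: B_def)
  show ?thesis
  proof (rule tendstoI)
    fix \<epsilon> :: real assume "\<epsilon> > 0"
    \<comment> \<open>During the time \<open>\<delta>\<close> after a time at which \<open>|g| \<ge> \<epsilon>\<close>, the Lipschitz bound keeps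
      \<open>|g| \<ge> \<epsilon> / 2\<close>, so that \<open>W\<close> loses at least \<open>\<eta>\<close>. This cannot happen once \<open>W\<close> is
      within \<open>\<eta>\<close> of its infimum.\<close>
    define \<delta> where "\<delta> = \<epsilon> / (2 * B)"
    define \<eta> where "\<eta> = c * (\<epsilon> / 2)\<^sup>2 * \<delta>"
    have "\<delta> > 0"
      using \<open>\<epsilon> > 0\<close> \<open>B > 0\<close> by (simp add: \<delta>_def)
    then have "\<eta> > 0"
      using \<open>\<epsilon> > 0\<close> \<open>c > 0\<close> by (simp add: \<eta>_def)
    define m where "m = Inf (W ` {0..})"
    have m_le: "m \<le> W t" if "t \<ge> 0" for t
      unfolding m_def using bdd that by (auto intro: cInf_lower)
    have "Inf (W ` {0..}) < m + \<eta>"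
      using \<open>\<eta> > 0\<close> by (simp add: m_def)
    from cInf_lessD[OF _ this] obtain t\<^sub>0 where t\<^sub>0: "t\<^sub>0 \<ge> 0" "W t\<^sub>0 < m + \<eta>"
      by auto
    have "norm (g t) < \<epsilon>" if t: "t \<ge> t\<^sub>0" for t
    proof (rule ccontr)
      assume "\<not> norm (g t) < \<epsilon>"
      obtain z where z: "t < z" "z < t + \<delta>" and drop: "W (t + \<delta>) - W t = D z * \<delta>"
        using mvt_on_half_line[OF deriv, of t "t + \<delta>"] \<open>\<delta> > 0\<close> t t\<^sub>0(1) by auto
      have "norm (g t - g z) \<le> K * \<bar>t - z\<bar>"
        using lipschitz_onD[OF lipschitz, of t z] z(1) t t\<^sub>0(1) by (auto simp: dist_norm)
      also have "\<dots> \<le> B * \<delta>"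
        using z \<open>K \<ge> 0\<close> by (intro mult_mono) (auto simp: B_def)
      also have "\<dots> = \<epsilon> / 2"
        using \<open>B > 0\<close> by (simp add: \<delta>_def)
      finally have "\<epsilon> / 2 \<le> norm (g z)"
        using \<open>\<not> norm (g t) < \<epsilon>\<close> norm_triangle_ineq2[of "g t" "g z"] by simp
      then have "c * (\<epsilon> / 2)\<^sup>2 \<le> c * (norm (g z))\<^sup>2"
        using \<open>\<epsilon> > 0\<close> \<open>c > 0\<close> by (intro mult_left_mono power_mono) auto
      then have "D z \<le> - (c * (\<epsilon> / 2)\<^sup>2)"
        using dissipation[of z] z(1) t t\<^sub>0(1) by simp
      then have "D z * \<delta> \<le> - (c * (\<epsilon> / 2)\<^sup>2) * \<delta>"
        using \<open>\<delta> > 0\<close> by (intro mult_right_mono) auto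
      then have "W (t + \<delta>) \<le> W t - \<eta>"
        using drop by (simp add: \<eta>_def)
      also have "\<dots> < m"
        using decreasing[OF t\<^sub>0(1) t] t\<^sub>0(2) by simp
      finally show False
        using m_le[of "t + \<delta>"] \<open>\<delta> > 0\<close> t t\<^sub>0(1) by simp
    qed
    then show "eventually (\<lambda>t. dist (g t) 0 < \<epsilon>) at_top"
      by (auto simp: eventually_at_top_linorder)
  qed
qed

section \<open>Convergence of the closed loop\<close>

text \<open>The term \<open>- grad f\<close> of the control is there to cancel the indefinite product \<open>grad f \<bullet> e\<close> that
  the error contributes to the derivative of the potential.\<close>

lemma closed_loop_lyapunov_derivative:
  fixes f :: "real ^ 'n \<Rightarrow> real"
  assumes "\<And>x. f differentiable at x" and "\<And>x. grad f differentiable at x"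
    and cl: "closed_loop_trajectory k1 k2 f T x1 x2 u" and t: "t \<in> T"
  shows "((\<lambda>s. phi f (x1 s) + (norm (err (alpha k1 f) (x1 s) (x2 s)))\<^sup>2 / 2) has_real_derivative
    - k1 * (norm (grad f (x1 t)))\<^sup>2 - k2 * (norm (err (alpha k1 f) (x1 t) (x2 t)))\<^sup>2) (at t within T)"
proof -
  define g where "g = (\<lambda>s. grad f (x1 s))"
  define e where "e = (\<lambda>s. err (alpha k1 f) (x1 s) (x2 s))"
  have T: "time_interval T" and x1: "(x1 has_vector_derivative x2 t) (at t within T)"
    and x2: "(x2 has_vector_derivative u t) (at t within T)"
    and u: "u t = control k1 k2 f T x1 x2 t"
    using cl t by (auto simp: closed_loop_trajectory_def system_trajectory_def)
  have e_eq: "e = (\<lambda>s. x2 s + k1 *\<^sub>R g s)"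
    by (simp add: e_def g_def err_def alpha_def)
  have "(g has_vector_derivative hessian f (x1 t) *v x2 t) (at t within T)"
    unfolding g_def using assms(2) x1 by (rule grad_has_vector_derivative_along_curve)
  then have "(e has_vector_derivative u t + k1 *\<^sub>R (hessian f (x1 t) *v x2 t)) (at t within T)"
    unfolding e_eq
    by (intro has_vector_derivative_add x2
        bounded_linear.has_vector_derivative[OF bounded_linear_scaleR_right])
  moreover have "u t + k1 *\<^sub>R (hessian f (x1 t) *v x2 t) = - k2 *\<^sub>R e t - g t"
    unfolding u control_eq[where ?x2.0 = x2, OF assms(2) T t x1] e_eq g_def by simp
  ultimately have "(e has_derivative (\<lambda>h. h *\<^sub>R (- k2 *\<^sub>R e t - g t))) (at t within T)"
    by (simp add: has_vector_derivative_def)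
  from has_derivative_inner[OF this this]
  have "((\<lambda>s. (norm (e s))\<^sup>2) has_real_derivative 2 * (e t \<bullet> (- k2 *\<^sub>R e t - g t))) (at t within T)"
    unfolding has_field_derivative_def power2_norm_eq_inner
    by (rule has_derivative_eq_rhs) (auto simp: inner_commute algebra_simps)
  from DERIV_add[OF DERIV_diff[OF has_real_derivative_along_curve[where y = x1, OF assms(1) x1]
      DERIV_const[of "INF y. f y"]] DERIV_cdivide[OF this, of 2]]
  have "((\<lambda>s. phi f (x1 s) + (norm (e s))\<^sup>2 / 2) has_real_derivative
      g t \<bullet> x2 t + e t \<bullet> (- k2 *\<^sub>R e t - g t)) (at t within T)"
    by (simp add: phi_def g_def)
  moreover have "g t \<bullet> x2 t + e t \<bullet> (- k2 *\<^sub>R e t - g t) = - k1 * (norm (g t))\<^sup>2 - k2 * (norm (e t))\<^sup>2"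
  proof -
    have "x2 t = e t - k1 *\<^sub>R g t"
      by (simp add: e_eq)
    then show ?thesis
      by (simp add: inner_diff_right inner_commute power2_norm_eq_inner)
  qed
  ultimately show ?thesis
    by (simp only: e_def g_def)
qed

lemma closed_loop_grad_tendsto_zero:
  fixes f :: "real ^ 'n \<Rightarrow> real"
  assumes diff: "\<And>x. f differentiable at x" "\<And>x. grad f differentiable at x"
    and smooth: "L_smooth L f" and bdd: "bdd_below (range f)" and k: "k1 > 0" "k2 > 0"
    and cl: "closed_loop_trajectory k1 k2 f {0..} x1 x2 u"
  shows "((\<lambda>t. grad f (x1 t)) \<longlongrightarrow> 0) at_top"
proof -
  define g where "g t = grad f (x1 t)" for t
  define e where "e t = err (alpha k1 f) (x1 t) (x2 t)" for t
  define W where "W t = phi f (x1 t) + (norm (e t))\<^sup>2 / 2" for t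
  define D where "D t = - k1 * (norm (g t))\<^sup>2 - k2 * (norm (e t))\<^sup>2" for t
  \<comment> \<open>a smoothness constant that is positive even if \<open>L\<close> is not, as for constant \<open>f\<close>\<close>
  define M where "M = \<bar>L\<bar> + 1"
  have "M > 0" "L \<le> M"
    by (auto simp: M_def)
  have "L_smooth M f"
    using smooth \<open>L \<le> M\<close> unfolding L_smooth_def
    by (meson mult_right_mono norm_ge_zero order_trans)
  have W_deriv: "(W has_real_derivative D t) (at t within {0..})" if "t \<ge> 0" for t
    using closed_loop_lyapunov_derivative[OF diff cl] that
    unfolding W_def D_def e_def g_def by simp
  have D_le: "D t \<le> - k1 * (norm (g t))\<^sup>2" for t
    using k(2) by (simp add: D_def)
  have phi_nonneg: "phi f x \<ge> 0" for x
    using cINF_lower[OF bdd, of x] by (simp add: phi_def)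
  have W_le: "W t \<le> W 0" if "t \<ge> 0" for t
  proof (rule nonincreasing_on_half_line[OF W_deriv _ order_refl that])
    show "D z \<le> 0" for z
      using D_le[of z] k(1) by (smt (verit) mult_nonneg_nonneg mult_minus_left zero_le_power2)
  qed
  \<comment> \<open>The velocity is \<open>e - k1 g\<close>, and \<open>W 0\<close> bounds both \<open>|e|\<^sup>2 / 2\<close> and the suboptimality gap.\<close>
  define A where "A = sqrt (2 * W 0) + k1 * sqrt (4 * M * W 0)"
  have x2_le: "norm (x2 t) \<le> A" if "t \<ge> 0" for t
  proof -
    have "phi f (x1 t) + (norm (e t))\<^sup>2 / 2 \<le> W 0"
      using W_le[OF that] by (simp only: W_def)
    moreover note phi_nonneg[of "x1 t"] zero_le_power2[of "norm (e t)"]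
    ultimately have "(norm (e t))\<^sup>2 \<le> 2 * W 0" and "phi f (x1 t) \<le> W 0"
      by linarith+
    then have "norm (e t) \<le> sqrt (2 * W 0)"
      by (simp add: real_le_rsqrt)
    moreover have "(norm (g t))\<^sup>2 \<le> 4 * M * W 0"
      using norm_grad_squared_le_phi[OF \<open>L_smooth M f\<close> \<open>M > 0\<close> bdd, of "x1 t"]
        \<open>phi f (x1 t) \<le> W 0\<close> \<open>M > 0\<close> unfolding g_def
      by (meson mult_left_mono order_trans less_imp_le mult_pos_pos zero_less_numeral)
    then have "norm (g t) \<le> sqrt (4 * M * W 0)"
      by (simp add: real_le_rsqrt)
    moreover have "x2 t = e t - k1 *\<^sub>R g t"
      by (simp add: e_def g_def err_def alpha_def)
    then have "norm (x2 t) \<le> norm (e t) + k1 * norm (g t)"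
      using norm_triangle_ineq4[of "e t" "k1 *\<^sub>R g t"] k(1) by simp
    ultimately show ?thesis
      using k(1) unfolding A_def by (smt (verit) mult_left_mono)
  qed
  then have "A \<ge> 0"
    using norm_ge_zero order_trans by blast
  have x1_lipschitz: "norm (x1 t - x1 s) \<le> A * norm (t - s)" if "t \<ge> 0" "s \<ge> 0" for s t
  proof (rule differentiable_bound[where S = "{0..}" and f' = "\<lambda>t h. h *\<^sub>R x2 t"])
    show "(x1 has_derivative (\<lambda>h. h *\<^sub>R x2 r)) (at r within {0..})" if "r \<in> {0..}" for r
      using cl that
      by (auto simp: closed_loop_trajectory_def system_trajectory_def has_vector_derivative_def)
    show "onorm (\<lambda>h. h *\<^sub>R x2 r) \<le> A" if "r \<in> {0..}" for r
      using x2_le[of r] that by (intro onorm_le) (simp add: mult.commute[of A] mult_left_mono)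
  qed (use that in auto)
  have "(M * A)-lipschitz_on {0..} g"
  proof (rule lipschitz_onI)
    fix s t :: real assume "s \<in> {0..}" "t \<in> {0..}"
    have "norm (g s - g t) \<le> M * norm (x1 s - x1 t)"
      using \<open>L_smooth M f\<close> by (simp add: L_smooth_def g_def)
    also have "\<dots> \<le> M * (A * norm (s - t))"
      using x1_lipschitz \<open>s \<in> {0..}\<close> \<open>t \<in> {0..}\<close> \<open>M > 0\<close> by (intro mult_left_mono) auto
    finally show "dist (g s) (g t) \<le> M * A * dist s t"
      by (simp add: dist_norm mult.assoc)
  qed (use \<open>M > 0\<close> \<open>A \<ge> 0\<close> in simp)
  moreover have "bdd_below (W ` {0..})"
    using phi_nonneg by (intro bdd_belowI2[where m = 0]) (simp add: W_def)
  ultimately show ?thesis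
    using tendsto_zero_of_dissipation[OF W_deriv D_le _ k(1)] unfolding g_def by blast
qed

theorem theorem2:
  fixes f :: "real ^ 'n \<Rightarrow> real" and L k1 :: real
  assumes "C2 f" and "convex_on UNIV f" and "L_smooth L f" and "bdd_below (range f)"
    and "k1 > 0"
  shows "(\<forall>x1 x2. err (alpha k1 f) x1 x2 = x2 + k1 *\<^sub>R grad f x1) \<and>
    (\<forall>T x1 x2. virtual_trajectory (alpha k1 f) T x1 x2 \<longrightarrow>
       (\<forall>t\<in>T. ((\<lambda>s. V1 f (x1 s)) has_real_derivative
           (- k1 * (norm (grad f (x1 t)))\<^sup>2 + grad f (x1 t) \<bullet> err (alpha k1 f) (x1 t) (x2 t)))
         (at t within T))) \<and>
    virtual_control_conditions f (V1 f) (alpha k1 f) 1 k1 1 \<and>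
    (\<forall>k2>0.
       (\<forall>T x1 x2 u. system_trajectory T x1 x2 u \<longrightarrow>
          (\<forall>t\<in>T. u t = control k1 k2 f T x1 x2 t \<longrightarrow>
             u t = - k2 *\<^sub>R (x2 t + k1 *\<^sub>R grad f (x1 t)) - grad f (x1 t)
                     - k1 *\<^sub>R (hessian f (x1 t) *v x2 t))) \<and>
       (\<forall>T X. time_interval T \<longrightarrow>
          ((\<exists>x2 u. closed_loop_trajectory k1 k2 f T X x2 u) \<longleftrightarrow> solves_second_order k1 k2 f T X)) \<and>
       (\<forall>x1 x2 u. closed_loop_trajectory k1 k2 f {0..} x1 x2 u \<longrightarrow>
          ((\<lambda>t. grad f (x1 t)) \<longlongrightarrow> 0) at_top))"
proof -
  have diff: "\<And>x. f differentiable at x" "\<And>x. grad f differentiable at x"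
    using assms(1) by (auto simp: C2_def)
  note energy = virtual_control_energy_derivative[OF diff(1)]
  have "virtual_control_conditions f (V1 f) (alpha k1 f) 1 k1 1"
    unfolding virtual_control_conditions_def
  proof (intro conjI allI impI ballI)
    show "V1 f x1 \<ge> 1 * phi f x1" for x1
      by (simp add: V1_def)
    show "bounded (alpha k1 f ` S)" if "bounded (grad f ` S)" for S
      using bounded_scaling[OF that, of "- k1"] by (simp add: image_image alpha_def)
  qed (use energy in simp)
  moreover have "u t = - k2 *\<^sub>R (x2 t + k1 *\<^sub>R grad f (x1 t)) - grad f (x1 t)
      - k1 *\<^sub>R (hessian f (x1 t) *v x2 t)"
    if "system_trajectory T x1 x2 u" "t \<in> T" "u t = control k1 k2 f T x1 x2 t" for k2 T x1 x2 u t
    using control_eq[OF diff(2), of T t x1 x2 k1 k2] that by (auto simp: system_trajectory_def)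
  moreover have "err (alpha k1 f) x1 x2 = x2 + k1 *\<^sub>R grad f x1" for x1 x2
    by (simp add: err_def alpha_def)
  ultimately show ?thesis
    using energy closed_loop_iff_second_order[OF diff(2)]
      closed_loop_grad_tendsto_zero[OF diff assms(3,4,5)]
    by (intro conjI allI impI ballI) blast+
qed

end
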